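(* Let $Q\subset\mathbf{R}^n$ be a $d$-dimensional polytope with vertices in $\mathbf{Z}^n$. For any shellable dissection of $Q$ into unimodular simplices, and for any shelling order of it, the associated $h$-vector is equivalent to the $h^*$-vector of $Q$ via \[\sum_{i=0}^d h^*_i\,t^i=t^{d+1}h(1/t),\] that is, $\sum_{i=0}^d h^*_i t^i=\sum_{j=0}^d h_jt^j$, where $h_j$ is the number of simplices $\sigma_i$ in the shelling order with $r_i=j$ and $h(x)=\sum_{j=0}^{d}h_j\,x^{d+1-j}$.
   Context: The $h^*$-polynomial ($h^*$-vector) of $Q$ is defined by $\sum_{i=0}^d h^*_i t^i=(1-t)^{d+1}\mathrm{Ehr}_Q(t)$, where $\mathrm{Ehr}_Q(t)=\sum_{k=0}^\infty|(k\cdot Q)\cap\mathbf{Z}^n|\,t^k$. A unimodular simplex is a lattice simplex whose vertices form an affine basis of the lattice $\mathbf{Z}^n\cap\mathrm{aff}(Q)$ (i.e., the vectors from a fixed vertex to the other vertices form a $\mathbf{Z}$-basis of the corresponding lattice of differences). A dissection of $Q$ is a set of mutually interior-disjoint maximal dimensional simplices whose union is $Q$ (intersections of two simplices need not be common faces). It is shellable if it admits a shelling order, i.e. a listing $\sigma_1,\dots,\sigma_N$ of its simplices such that for each $i=2,\dots,N$ the set $\sigma_i\cap\bigcup_{j=1}^{i-1}\sigma_j$ coincides with the union of a positive number of facets of $\sigma_i$. Denote this number of facets by $r_i$ for $i\ge2$, and put $r_1=0$. The $h$-vector associated to the shelling order is $(h_0,h_1,\dots)$, where $h_k$ is the number of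 simplices $\sigma_i$ with $r_i=k$ (and $h_k=0$ for $k>d$); in polynomial form, $h(x)=h_d\,x+h_{d-1}x^2+\cdots+h_1x^d+h_0x^{d+1}$. *)

theory Defs
  imports "HOL-Analysis.Analysis" "HOL-Computational_Algebra.Computational_Algebra"
begin

definition int_lattice :: "(real ^ 'n) set" where
  "int_lattice = {x. \<forall>i. x $ i \<in> \<int>}"

definition vertices :: "'a::euclidean_space set \<Rightarrow> 'a set" where
  "vertices P = {v. v extreme_point_of P}"

definition lattice_polytope :: "(real ^ 'n) set \<Rightarrow> bool" where
  "lattice_polytope P \<longleftrightarrow> polytope P \<and> vertices P \<subseteq> int_lattice"

definition ehrhart_series :: "(real ^ 'n) set \<Rightarrow> int fps" where
  "ehrhart_series Q = Abs_fps (\<lambda>k. int (card ((\<lambda>x. real k *\<^sub>R x) ` Q \<inter> int_lattice)))"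

text \<open>The polynomial is unique because \<^const>\<open>fps_of_poly\<close> is injective. That it exists for every
  lattice polytope is a theorem of Stanley.\<close>

definition hstar_poly :: "(real ^ 'n) set \<Rightarrow> int poly" where
  "hstar_poly Q = (let d = nat (aff_dim Q) in
     THE p. degree p \<le> d \<and> fps_of_poly p = (1 - fps_X) ^ (d + 1) * ehrhart_series Q)"

definition hstar :: "(real ^ 'n) set \<Rightarrow> nat \<Rightarrow> int" where
  "hstar Q i = coeff (hstar_poly Q) i"

global_interpretation int_module: module "\<lambda>(k::int) (x::'a::real_vector). real_of_int k *\<^sub>R x"
  by unfold_locales (simp_all add: algebra_simps)

definition is_int_basis :: "'a::real_vector set \<Rightarrow> 'a set \<Rightarrow> bool" where
  "is_int_basis B L \<longleftrightarrow> int_module.independent B \<and> int_module.span B = L"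

text \<open>Here \<open>\<Lambda>\<close> is an affine lattice, namely \<open>int_lattice \<inter> affine hull Q\<close> in the application.\<close>

definition unimodular_simplex :: "'a::euclidean_space set \<Rightarrow> 'a set \<Rightarrow> bool" where
  "unimodular_simplex \<Lambda> S \<longleftrightarrow> (\<exists>k. k simplex S) \<and> vertices S \<subseteq> \<Lambda> \<and>
     (\<exists>v \<in> vertices S. is_int_basis ((\<lambda>w. w - v) ` (vertices S - {v})) {x - y |x y. x \<in> \<Lambda> \<and> y \<in> \<Lambda>})"

text \<open>\<open>Q\<close> need not be full-dimensional in the ambient space, so interiors are relative interiors.\<close>

definition dissection :: "'a::euclidean_space set \<Rightarrow> 'a set set \<Rightarrow> bool" where
  "dissection Q D \<longleftrightarrow> finite D \<and> (\<forall>S\<in>D. aff_dim Q simplex S) \<and> \<Union>D = Q \<and>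
     pairwise (\<lambda>S T. rel_interior S \<inter> rel_interior T = {}) D"

definition unimodular_dissection :: "(real ^ 'n) set \<Rightarrow> (real ^ 'n) set set \<Rightarrow> bool" where
  "unimodular_dissection Q D \<longleftrightarrow>
     dissection Q D \<and> (\<forall>S\<in>D. unimodular_simplex (int_lattice \<inter> affine hull Q) S)"

text \<open>The list \<open>\<sigma>\<close> is indexed from \<open>0\<close>, so \<open>\<sigma> ! i\<close> is the simplex written \<open>\<sigma>\<^sub>i\<^sub>+\<^sub>1\<close> on paper.\<close>

definition attaching_facets ::
  "'a::euclidean_space set list \<Rightarrow> nat \<Rightarrow> 'a set set \<Rightarrow> bool" where
  "attaching_facets \<sigma> i \<F> \<longleftrightarrow>
     \<F> \<subseteq> {F. F facet_of \<sigma> ! i} \<and> \<F> \<noteq> {} \<and> \<sigma> ! i \<inter> (\<Union>j<i. \<sigma> ! j) = \<Union>\<F>"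

definition shelling_order :: "'a::euclidean_space set set \<Rightarrow> 'a set list \<Rightarrow> bool" where
  "shelling_order D \<sigma> \<longleftrightarrow> distinct \<sigma> \<and> set \<sigma> = D \<and>
     (\<forall>i. 1 \<le> i \<and> i < length \<sigma> \<longrightarrow> (\<exists>\<F>. attaching_facets \<sigma> i \<F>))"

text \<open>The attaching facets are determined by their union, so the number of them is well defined.\<close>

lemma attaching_facets_unique:
  assumes S: "k simplex (\<sigma> ! i)"
    and F: "attaching_facets \<sigma> i \<F>" and G: "attaching_facets \<sigma> i \<G>"
  shows "\<F> = \<G>"
proof -
  have poly: "polytope (\<sigma> ! i)"
    using S simplex_imp_polytope by blast
  have *: "\<A> \<subseteq> \<B>" if A: "attaching_facets \<sigma> i \<A>" and B: "attaching_facets \<sigma> i \<B>" for \<A> \<B>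
  proof
    fix A assume "A \<in> \<A>"
    then have fA: "A facet_of \<sigma> ! i" and sub: "A \<subseteq> \<Union>\<B>"
      using A B unfolding attaching_facets_def by auto
    have cA: "convex A" and neA: "A \<noteq> {}"
      using fA unfolding facet_of_def by (auto intro: face_of_imp_convex)
    obtain x where x: "x \<in> rel_interior A"
      using cA neA rel_interior_eq_empty by blast
    then obtain H where H: "H \<in> \<B>" "x \<in> H"
      using sub rel_interior_subset by blast
    then have fH: "H facet_of \<sigma> ! i"
      using B unfolding attaching_facets_def by auto
    have "A \<subseteq> H"
      by (rule subset_of_face_of[of H "\<sigma> ! i"])
         (use fA fH x H in \<open>auto simp: facet_of_def dest: face_of_imp_subset\<close>)
    then have "A face_of H"
      using fA fH face_of_subset face_of_imp_subset unfolding facet_of_def by blast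
    moreover have "convex H"
      using fH unfolding facet_of_def by (auto intro: face_of_imp_convex)
    ultimately have "A = H"
      using face_of_aff_dim_lt[of H A] fA fH unfolding facet_of_def by auto
    then show "A \<in> \<B>"
      using H by simp
  qed
  show ?thesis
    using *[OF F G] *[OF G F] by blast
qed

definition attaching_number :: "'a::euclidean_space set list \<Rightarrow> nat \<Rightarrow> nat" where
  "attaching_number \<sigma> i =
     (if i = 0 then 0 else THE r. \<exists>\<F>. attaching_facets \<sigma> i \<F> \<and> r = card \<F>)"

definition h_vector :: "'a::euclidean_space set list \<Rightarrow> nat \<Rightarrow> nat" where
  "h_vector \<sigma> k = card {i. i < length \<sigma> \<and> attaching_number \<sigma> i = k}"

definition h_poly :: "nat \<Rightarrow> 'a::euclidean_space set list \<Rightarrow> real poly" where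
  "h_poly d \<sigma> = (\<Sum>j\<le>d. monom (real (h_vector \<sigma> j)) (d + 1 - j))"

end

theory Submission
  imports Defs
begin

text \<open>
  Let \<open>r\<^sub>i\<close> be the number of facets along which the \<open>i\<close>-th simplex of the shelling is glued to the
  earlier ones. The part of this simplex that is new, meaning outside all earlier simplices, is a
  half-open simplex: the simplex with \<open>r\<^sub>i\<close> of its facets removed. These parts form a partition of
  \<open>Q\<close>, so the numbers of lattice points of their dilates add up to those of \<open>Q\<close>.

  Unimodularity makes each summand easy to count. The lattice points of the \<open>k\<close>-th dilate of a
  unimodular simplex with vertex set \<open>C\<close> are exactly the combinations of the vertices with natural
  weights of total \<open>k\<close>, and removing the facet opposite to a vertex \<open>u\<close> demands that the weight of
  \<open>u\<close> be positive (\<open>half_open_simplex_lattice_points\<close>). Each of the \<open>d + 1\<close> vertices therefore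
  contributes a factor \<open>1/(1 - X)\<close> or \<open>X/(1 - X)\<close> to the generating function, which is
  \<open>X ^ r\<^sub>i / (1 - X) ^ (d + 1)\<close> (\<open>weights_generating_function\<close>). Summing over \<open>i\<close> gives
  \<open>(1 - X) ^ (d + 1) Ehr\<^sub>Q = (\<Sum>i. X ^ r\<^sub>i)\<close>, and grouping equal exponents gives \<open>\<Sum>j. h\<^sub>j X ^ j\<close>. The
  dilation factor \<open>0\<close> needs a separate look, because it maps every nonempty part to the origin:
  there the origin is counted once for \<open>Q\<close>, and on the other side only the first simplex, the only
  one with \<open>r\<^sub>i = 0\<close>, contributes.

  One point is not combinatorial: the \<open>h\<close>-vector stops at index \<open>d\<close>, so no simplex may be glued
  along all of its facets. Suppose that one were. As long as this has not happened, the
  union of an initial segment of the shelling is an absolute retract, since a simplex is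
  added along a union of facets that all share a vertex, hence along a contractible set
  (\<open>shelling_AR_initial_segment\<close>). This union now contains the boundary of the new simplex but
  avoids every point of its relative interior, so projecting from such a point retracts the union onto the
  boundary. The boundary would then be an absolute retract, which contradicts Brouwer's fixed point
  theorem (\<open>not_AR_rel_frontier\<close>).
\<close>

section \<open>Shellings and absolute retracts\<close>

text \<open>
  All relative boundaries of bounded convex sets of the same dimension are homeomorphic, so \<open>S\<close> may
  be replaced by a round ball \<open>B\<close> in the affine hull of \<open>S\<close>. A retraction of \<open>B\<close> onto its bounding
  sphere, followed by the antipodal map, would be a self-map of \<open>B\<close> without fixed points.
\<close>

lemma not_AR_rel_frontier:
  fixes S :: "'a::euclidean_space set"
  assumes "bounded S" "convex S" "S \<noteq> {}"
  shows "\<not> AR (rel_frontier S)"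
proof
  assume AR: "AR (rel_frontier S)"
  define A where "A = affine hull S"
  obtain a where a: "a \<in> A"
    using assms(3) by (auto simp: A_def intro: hull_inc)
  define B where "B = cball a 1 \<inter> A"
  have aff: "affine A" by (simp add: A_def)
  have int: "interior (cball a 1) \<inter> A \<noteq> {}"
    using a by (metis IntI centre_in_ball empty_iff interior_cball zero_less_one)
  have dim: "aff_dim B = aff_dim S"
  proof -
    have "aff_dim B = aff_dim A"
      using aff_dim_convex_Int_nonempty_interior[of A "cball a 1"] int aff
      by (simp add: B_def affine_imp_convex Int_commute)
    then show ?thesis by (simp add: A_def)
  qed
  have cB: "convex B" "bounded B" "compact B" "B \<noteq> {}"
    unfolding B_def
    using aff by (simp_all add: affine_imp_convex convex_Int bounded_Int affine_closed compact_Int_closed)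
      (use a in \<open>metis IntI centre_in_cball empty_iff zero_le_one\<close>)
  have fr: "rel_frontier B = sphere a 1 \<inter> A"
    using convex_affine_rel_frontier_Int[OF _ aff int] by (simp add: B_def)
  have "rel_frontier S homeomorphic rel_frontier B"
    using homeomorphic_rel_frontiers_convex_bounded_sets assms cB dim by metis
  then have "AR (sphere a 1 \<inter> A)"
    using AR homeomorphic_AR_iff_AR fr by metis
  moreover have "closedin (top_of_set B) (sphere a 1 \<inter> A)"
    using aff by (intro closed_subset) (auto simp: B_def affine_closed)
  ultimately have "(sphere a 1 \<inter> A) retract_of B"
    by (simp add: AR_imp_retract)
  then obtain r where r: "continuous_on B r" "\<And>x. x \<in> B \<Longrightarrow> r x \<in> sphere a 1 \<inter> A"
      "\<And>x. x \<in> sphere a 1 \<inter> A \<Longrightarrow> r x = x"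
    unfolding retract_of_def retraction_def by blast
  obtain x where x: "x \<in> B" "2 *\<^sub>R a - r x = x"
  proof (rule brouwer[OF cB(3,1,4)])
    show "continuous_on B (\<lambda>x. 2 *\<^sub>R a - r x)" by (intro continuous_intros r)
    show "(\<lambda>x. 2 *\<^sub>R a - r x) \<in> B \<rightarrow> B"
    proof
      fix x assume "x \<in> B"
      then have rx: "r x \<in> sphere a 1" "r x \<in> A" using r by auto
      have "2 *\<^sub>R a - r x = 2 *\<^sub>R a + (- 1) *\<^sub>R r x" by simp
      also have "\<dots> \<in> A" by (rule mem_affine[OF aff a rx(2)]) simp
      moreover have "dist a (2 *\<^sub>R a - r x) = 1"
      proof -
        have "a - (2 *\<^sub>R a - r x) = r x - a" by (simp add: scaleR_2)
        then show ?thesis using rx(1) by (simp only: dist_norm) (simp add: dist_norm norm_minus_commute)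
      qed
      ultimately show "2 *\<^sub>R a - r x \<in> B" by (simp add: B_def)
    qed
  qed (use that in blast)
  from x(2) have rx: "r x = 2 *\<^sub>R a - x" by (metis add_diff_cancel_left' diff_add_cancel)
  have "dist a x = dist a (r x)"
    unfolding rx dist_norm by (simp add: scaleR_2 norm_minus_commute)
  then have "x \<in> sphere a 1 \<inter> A" using r(2)[OF x(1)] x(1) by (auto simp: B_def)
  then have "r x = x" "dist a x = 1" using r(3) by auto
  then have "2 *\<^sub>R x = 2 *\<^sub>R a" using rx by (simp add: scaleR_2 algebra_simps)
  then show False using \<open>dist a x = 1\<close> by simp
qed

text \<open>
  The union is star-shaped about \<open>v\<close>, hence contractible, and a finite union of closed convex sets
  is an absolute neighbourhood retract.
\<close>

lemma AR_Union_convex_common_point: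
  fixes \<F> :: "'a::euclidean_space set set"
  assumes "finite \<F>" "\<And>F. F \<in> \<F> \<Longrightarrow> closed F \<and> convex F \<and> v \<in> F" "\<F> \<noteq> {}"
  shows "AR (\<Union>\<F>)"
proof -
  have "ANR (\<Union>\<F>)"
    using assms by (intro ANR_finite_Union_convex_closed) auto
  moreover have "starlike (\<Union>\<F>)"
    unfolding starlike_def
  proof (intro bexI ballI)
    show "v \<in> \<Union>\<F>" using assms by auto
    fix x assume "x \<in> \<Union>\<F>"
    then obtain F where "F \<in> \<F>" "x \<in> F" by auto
    then have "closed_segment v x \<subseteq> F" using assms(2) by (simp add: closed_segment_subset)
    then show "closed_segment v x \<subseteq> \<Union>\<F>" using \<open>F \<in> \<F>\<close> by auto
  qed
  ultimately show ?thesis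
    using assms by (auto simp: AR_ANR starlike_imp_contractible)
qed

text \<open>
  A facet of a simplex is determined by the vertex opposite to it, so that a set of facets may be
  counted by vertices.
\<close>

lemma facets_of_simplex_by_vertices:
  assumes "\<not> affine_dependent C" and "\<F> \<subseteq> {F. F facet_of convex hull C}"
  obtains U where "U \<subseteq> C" "\<F> = (\<lambda>u. convex hull (C - {u})) ` U" "card \<F> = card U"
proof -
  define U where "U = {u\<in>C. convex hull (C - {u}) \<in> \<F>}"
  have eq: "\<F> = (\<lambda>u. convex hull (C - {u})) ` U"
    using assms facet_of_convex_hull_affine_independent[OF assms(1)] by (auto simp: U_def)
  have inj: "inj_on (\<lambda>u. convex hull (C - {u})) C"
  proof (rule inj_onI)
    fix u w assume *: "u \<in> C" "w \<in> C" "convex hull (C - {u}) = convex hull (C - {w})"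
    show "u = w"
    proof (rule ccontr)
      assume "u \<noteq> w"
      then have "u \<in> affine hull (C - {u})"
        using * hull_inc[of u "C - {w}" convex] convex_hull_subset_affine_hull by force
      then show False using assms(1) * by (auto simp: affine_dependent_def)
    qed
  qed
  have "U \<subseteq> C" by (auto simp: U_def)
  then have "card \<F> = card U"
    unfolding eq by (rule card_image[OF inj_on_subset[OF inj]])
  then show ?thesis using that[OF \<open>U \<subseteq> C\<close> eq] by blast
qed

text \<open>
  The vertex opposite to a facet outside \<open>\<F>\<close> lies in every member of \<open>\<F>\<close>.
\<close>

lemma AR_Union_proper_facets:
  assumes S: "k simplex S" and sub: "\<F> \<subset> {F. F facet_of S}" and ne: "\<F> \<noteq> {}"
  shows "AR (\<Union>\<F>)"
proof -
  obtain C where C: "\<not> affine_dependent C" "S = convex hull C" "finite C"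
    using S by (auto simp: simplex)
  obtain U where U: "U \<subseteq> C" "\<F> = (\<lambda>u. convex hull (C - {u})) ` U"
    using facets_of_simplex_by_vertices[OF C(1)] sub C(2) by (metis psubset_imp_subset)
  obtain F where F: "F facet_of S" "F \<notin> \<F>" using sub by blast
  then obtain v where v: "v \<in> C" "F = convex hull (C - {v})"
    using facet_of_convex_hull_affine_independent[OF C(1)] C(2) by blast
  then have "v \<notin> U" using U F by auto
  show ?thesis
  proof (rule AR_Union_convex_common_point[of _ v])
    show "finite \<F>" using U C by (auto intro: finite_subset)
    fix G assume "G \<in> \<F>"
    then obtain u where u: "u \<in> U" "G = convex hull (C - {u})" using U by auto
    then have "v \<in> C - {u}" using v \<open>v \<notin> U\<close> by auto
    then show "closed G \<and> convex G \<and> v \<in> G"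
      using u C by (auto simp: hull_inc finite_imp_compact_convex_hull compact_imp_closed)
  qed (fact ne)
qed

text \<open>
  If all facets were used, the earlier union would contain the boundary of the new simplex and no
  point of its relative interior. Radial projection from such a point would then retract
  an absolute retract onto that boundary.
\<close>

lemma attaching_facets_omit_a_facet:
  fixes \<sigma> :: "'a::euclidean_space set list"
  assumes "k simplex (\<sigma> ! i)" "0 \<le> k"
    and hull: "(\<Union>j<i. \<sigma> ! j) \<subseteq> affine hull (\<sigma> ! i)"
    and AR: "AR (\<Union>j<i. \<sigma> ! j)" and F: "attaching_facets \<sigma> i \<F>"
  shows "\<F> \<noteq> {F. F facet_of \<sigma> ! i}"
proof
  assume all: "\<F> = {F. F facet_of \<sigma> ! i}"
  let ?S = "\<sigma> ! i" and ?U = "\<Union>j<i. \<sigma> ! j"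
  have poly: "polytope ?S" using assms(1) simplex_imp_polytope by blast
  have ne: "?S \<noteq> {}" using assms(1,2) using aff_dim_simplex[of k "\<sigma> ! i"] by auto
  have cb: "convex ?S" "bounded ?S"
    using poly by (auto simp: polytope_imp_convex polytope_imp_bounded)
  have fr: "rel_frontier ?S = ?S \<inter> ?U"
    using rel_frontier_of_polyhedron[OF polytope_imp_polyhedron[OF poly]] F all
    by (simp add: attaching_facets_def)
  obtain a where a: "a \<in> rel_interior ?S" using ne cb rel_interior_eq_empty by blast
  then have "a \<in> ?S" "a \<notin> rel_frontier ?S"
    using rel_interior_subset by (auto simp: rel_frontier_def)
  then have "a \<notin> ?U" using fr by auto
  have "rel_frontier ?S retract_of ?U"
    by (rule retract_of_subset[OF rel_frontier_retract_of_punctured_affine_hull[OF cb(2,1) a]])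
      (use hull fr \<open>a \<notin> ?U\<close> in auto)
  then show False using AR_retract_of_AR[OF AR] not_AR_rel_frontier[OF cb(2,1) ne] by blast
qed

text \<open>
  Gluing two closed absolute retracts along an absolute retract gives an absolute retract. By the
  induction hypothesis the next simplex is glued along a proper subset of its facets, and the union
  of those is an absolute retract.
\<close>

lemma shelling_AR_initial_segment:
  fixes \<sigma> :: "'a::euclidean_space set list"
  assumes simp: "\<And>j. j < n \<Longrightarrow> k simplex (\<sigma> ! j)" and k: "0 \<le> k"
    and hull: "\<And>j. j < n \<Longrightarrow> affine hull (\<sigma> ! j) = A"
    and shell: "\<And>i. 1 \<le> i \<Longrightarrow> i < n \<Longrightarrow> \<exists>\<F>. attaching_facets \<sigma> i \<F>"
    and i: "1 \<le> i" "i \<le> n"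
  shows "AR (\<Union>j<i. \<sigma> ! j)"
  using i
proof (induction i rule: nat_induct_at_least)
  case base
  have "\<sigma> ! 0 \<noteq> {}" using simp[of 0] base k aff_dim_simplex[of k "\<sigma> ! 0"] by auto
  then show ?case using simp[of 0] base by (simp add: convex_imp_AR convex_simplex lessThan_Suc)
next
  case (Suc i)
  then obtain \<F> where F: "attaching_facets \<sigma> i \<F>" using shell[of i] by auto
  have AR: "AR (\<Union>j<i. \<sigma> ! j)" using Suc by auto
  have S: "k simplex (\<sigma> ! i)" using Suc simp by auto
  have "\<sigma> ! j \<subseteq> affine hull (\<sigma> ! i)" if "j < i" for j
    using hull[of i] hull[of j] hull_subset[of "\<sigma> ! j" affine] that Suc.prems by auto
  then have "\<F> \<noteq> {F. F facet_of \<sigma> ! i}"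
    using attaching_facets_omit_a_facet[OF S k _ AR F] by blast
  then have "AR (\<Union>\<F>)"
    using AR_Union_proper_facets[OF S] F by (auto simp: attaching_facets_def)
  then have "AR (\<sigma> ! i \<inter> (\<Union>j<i. \<sigma> ! j))" using F by (simp add: attaching_facets_def)
  moreover have "closed (\<sigma> ! j)" if "j \<le> i" for j
    using simp[of j] that Suc.prems closed_simplex by auto
  moreover have "AR (\<sigma> ! i)"
  proof -
    have "\<sigma> ! i \<noteq> {}" using S k aff_dim_simplex[of k "\<sigma> ! i"] by auto
    then show ?thesis using S by (simp add: convex_imp_AR convex_simplex)
  qed
  ultimately have "AR (\<sigma> ! i \<union> (\<Union>j<i. \<sigma> ! j))"
    using AR by (intro AR_closed_Un) auto
  then show ?case by (simp add: lessThan_Suc)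
qed

section \<open>Lattice points of half-open unimodular simplices\<close>

text \<open>
  The condition of vanishing outside \<open>C\<close> makes a weight on \<open>C\<close> a unique function, so that
  cardinalities count weights.
\<close>

definition weights :: "'a set \<Rightarrow> 'a set \<Rightarrow> nat \<Rightarrow> ('a \<Rightarrow> nat) set" where
  "weights C U k = {f. (\<forall>x. x \<notin> C \<longrightarrow> f x = 0) \<and> (\<forall>u\<in>U. 1 \<le> f u) \<and> sum f C = k}"

text \<open>
  Splitting off the weight of one vertex is the combinatorial form of multiplying generating
  functions.
\<close>

lemma weights_insert:
  assumes "finite C" "c \<notin> C" "U \<subseteq> insert c C"
  shows "bij_betw (\<lambda>(j, f). f(c := j))
           (SIGMA j:{j. j \<le> k \<and> (c \<in> U \<longrightarrow> 1 \<le> j)}. weights C (U - {c}) (k - j))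
           (weights (insert c C) U k)"
proof (rule bij_betw_byWitness[where f' = "\<lambda>f. (f c, f(c := 0))"], goal_cases)
  case 1
  then show ?case using assms by (auto simp: weights_def fun_eq_iff)
next
  case 2
  then show ?case by auto
next
  case 3
  have "sum (f(c := j)) (insert c C) = j + sum f C" for f :: "'a \<Rightarrow> nat" and j
  proof -
    have "sum (f(c := j)) C = sum f C" by (rule sum.cong) (use assms(2) in auto)
    then show ?thesis using assms(1,2) by (simp add: sum.insert del: fun_upd_apply) simp
  qed
  then show ?case using assms by (auto simp: weights_def)
next
  case 4
  have "sum (f(c := 0)) C = sum f C" for f :: "'a \<Rightarrow> nat"
    using assms(2) by (intro sum.cong) auto
  then show ?case using assms by (auto simp: weights_def split: if_splits)
qed

lemma finite_weights:
  assumes "finite C" "U \<subseteq> C"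
  shows "finite (weights C U k)"
proof (rule finite_subset)
  show "weights C U k \<subseteq> {f. \<forall>x. (x \<in> C \<longrightarrow> f x \<in> {..k}) \<and> (x \<notin> C \<longrightarrow> f x = 0)}"
    using member_le_sum[of _ C] assms(1) by (fastforce simp: weights_def)
  show "finite {f. \<forall>x. (x \<in> C \<longrightarrow> f x \<in> {..k}) \<and> (x \<notin> C \<longrightarrow> f x = 0)}"
    by (rule finite_set_of_finite_funs) (use assms in auto)
qed

text \<open>
  Both sides are multiplicative over the elements of \<open>C\<close>. The factor of one element on the left is
  \<open>1 - X\<close> times \<open>1 + X + X\<^sup>2 + \<dots>\<close>, with the term \<open>1\<close> left out if the weight has to be positive.
\<close>

lemma weights_generating_function:
  assumes "finite C" "U \<subseteq> C"
  shows "(1 - fps_X) ^ card C * Abs_fps (\<lambda>k. int (card (weights C U k))) = fps_X ^ card U"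
  using assms
proof (induction C arbitrary: U rule: finite_induct)
  case empty
  have *: "weights {} {} k = (if k = 0 then {\<lambda>_::'a. 0} else {})" for k :: nat
    by (auto simp: weights_def)
  then have "Abs_fps (\<lambda>k. int (card (weights ({}::'a set) {} k))) = 1"
    by (intro fps_ext) (simp add: *)
  then show ?case using empty by simp
next
  case (insert c C)
  define e :: nat where "e = (if c \<in> U then 1 else 0)"
  define E :: "int fps" where "E = Abs_fps (\<lambda>j. if e \<le> j then 1 else 0)"
  let ?W = "\<lambda>C U. Abs_fps (\<lambda>k. int (card (weights C U k)))"
  have "(1 - fps_X) * E = fps_X ^ e"
    by (intro fps_ext) (auto simp: E_def e_def left_diff_distrib fps_X_power_nth)
  (* E is the generating function of the weight of c, so this is a Cauchy product. *)
  moreover have "?W (insert c C) U = E * ?W C (U - {c})"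
  proof (intro fps_ext)
    fix k :: nat
    let ?J = "{j. j \<le> k \<and> (c \<in> U \<longrightarrow> 1 \<le> j)}"
    have "card (weights (insert c C) U k)
        = card (SIGMA j:?J. weights C (U - {c}) (k - j))"
      by (rule bij_betw_same_card[OF weights_insert, symmetric]) (use insert in auto)
    also have "\<dots> = (\<Sum>j\<in>?J. card (weights C (U - {c}) (k - j)))"
      using insert by (intro card_SigmaI) (auto intro!: finite_weights)
    finally have "int (card (weights (insert c C) U k))
        = (\<Sum>j\<in>?J. int (card (weights C (U - {c}) (k - j))))" by simp
    also have "\<dots> = (\<Sum>j=0..k. E $ j * int (card (weights C (U - {c}) (k - j))))"
      by (rule sum.mono_neutral_cong_left) (auto simp: E_def e_def)
    finally show "?W (insert c C) U $ k = (E * ?W C (U - {c})) $ k"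
      by (simp add: fps_mult_nth)
  qed
  moreover have "(1 - fps_X) ^ card C * ?W C (U - {c}) = fps_X ^ card (U - {c})"
    using insert.prems by (intro insert.IH) auto
  moreover have "card U = e + card (U - {c})"
  proof (cases "c \<in> U")
    case True
    have "finite U" using insert finite_subset by blast
    with True show ?thesis using card.remove[of U c] by (simp add: e_def)
  qed (simp add: e_def)
  ultimately have "(1 - fps_X) ^ card (insert c C) * ?W (insert c C) U
      = ((1 - fps_X) * E) * ((1 - fps_X) ^ card C * ?W C (U - {c}))"
    using insert.hyps by (simp add: mult_ac)
  then show ?case
    using \<open>(1 - fps_X) * E = _\<close> \<open>card U = _\<close> \<open>(1 - fps_X) ^ card C * _ = _\<close>
    by (simp only: power_add)
qed

text \<open>
  The coefficient at \<open>0\<close> tells apart the closed simplex, for which no facet is removed.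
\<close>

lemma weights_0:
  assumes "finite C" "U \<subseteq> C"
  shows "card (weights C U 0) = (if U = {} then 1 else 0)"
proof -
  have "weights C U 0 = (if U = {} then {\<lambda>_. 0} else {})"
  proof (cases "U = {}")
    case True
    then show ?thesis using assms(1) by (auto simp: weights_def fun_eq_iff)
  next
    case False
    then obtain u where "u \<in> U" "u \<in> C" using assms(2) by blast
    then have "f \<notin> weights C U 0" for f
      using assms(1) by (fastforce simp: weights_def)
    then show ?thesis using False by auto
  qed
  then show ?thesis by simp
qed

lemma affine_independent_coeffs_unique:
  fixes C :: "'a::real_vector set"
  assumes "finite C" "\<not> affine_dependent C" "sum f C = sum g C"
    and "(\<Sum>v\<in>C. f v *\<^sub>R v) = (\<Sum>v\<in>C. g v *\<^sub>R v)" and "v \<in> C"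
  shows "f v = g v"
proof (rule ccontr)
  assume "f v \<noteq> g v"
  then have "\<exists>U. sum U C = 0 \<and> (\<exists>v\<in>C. U v \<noteq> 0) \<and> (\<Sum>v\<in>C. U v *\<^sub>R v) = 0"
    using assms by (intro exI[of _ "\<lambda>v. f v - g v"])
      (auto simp: sum_subtractf scaleR_diff_left)
  then show False using assms affine_dependent_explicit_finite[of C] by blast
qed

lemma barycentric_notin_facet_iff:
  fixes C :: "'a::euclidean_space set"
  assumes "\<not> affine_dependent C" "\<And>v. v \<in> C \<Longrightarrow> 0 \<le> l v" "sum l C = 1" "u \<in> C"
  shows "(\<Sum>v\<in>C. l v *\<^sub>R v) \<in> convex hull (C - {u}) \<longleftrightarrow> l u = 0"
proof -
  have fin: "finite C" using assms(1) aff_independent_finite by blast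
  show ?thesis
  proof
    assume "l u = 0"
    then have "(\<Sum>v\<in>C. l v *\<^sub>R v) = (\<Sum>v\<in>C - {u}. l v *\<^sub>R v)" "sum l (C - {u}) = 1"
      using assms(3,4) fin by (simp_all add: sum.remove)
    then show "(\<Sum>v\<in>C. l v *\<^sub>R v) \<in> convex hull (C - {u})"
      using assms(2) fin by (auto simp: convex_hull_finite)
  next
    assume "(\<Sum>v\<in>C. l v *\<^sub>R v) \<in> convex hull (C - {u})"
    then obtain m where m: "sum m (C - {u}) = 1"
        "(\<Sum>v\<in>C - {u}. m v *\<^sub>R v) = (\<Sum>v\<in>C. l v *\<^sub>R v)"
      using fin by (auto simp: convex_hull_finite)
    define m' where "m' = m(u := 0)"
    have "sum m' (C - {u}) = sum m (C - {u})"
         "(\<Sum>v\<in>C - {u}. m' v *\<^sub>R v) = (\<Sum>v\<in>C - {u}. m v *\<^sub>R v)"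
      by (auto simp: m'_def intro!: sum.cong)
    then have "sum m' C = 1" "(\<Sum>v\<in>C. m' v *\<^sub>R v) = (\<Sum>v\<in>C. l v *\<^sub>R v)"
      using m sum.remove[OF fin assms(4), of m'] sum.remove[OF fin assms(4), of "\<lambda>v. m' v *\<^sub>R v"]
      by (auto simp: m'_def)
    then have "m' u = l u"
      using assms(3,4) affine_independent_coeffs_unique[OF fin assms(1), of m' l u] by simp
    then show "l u = 0" by (simp add: m'_def)
  qed
qed

lemma int_lattice_sum:
  assumes "\<And>v. v \<in> C \<Longrightarrow> v \<in> int_lattice"
  shows "(\<Sum>v\<in>C. real_of_int (f v) *\<^sub>R v) \<in> int_lattice"
  using assms by (auto simp: int_lattice_def intro!: Ints_sum Ints_mult)

lemma int_lattice_add: "x \<in> int_lattice \<Longrightarrow> y \<in> int_lattice \<Longrightarrow> x + y \<in> int_lattice"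
  and int_lattice_diff: "x \<in> int_lattice \<Longrightarrow> y \<in> int_lattice \<Longrightarrow> x - y \<in> int_lattice"
  by (auto simp: int_lattice_def)

text \<open>
  Although \<open>k y\<close> need not lie in \<open>A\<close>, the vector \<open>k y - k v\<close> is parallel to \<open>A\<close> for any vertex \<open>v\<close>.
  It is a difference of lattice points of \<open>A\<close>, hence an integer combination of the edges at \<open>v\<close>.
  Giving \<open>v\<close> the remaining weight makes the total \<open>k\<close>.
\<close>

lemma unimodular_integer_coordinates:
  fixes C :: "(real ^ 'n) set"
  assumes C: "\<not> affine_dependent C" "C \<subseteq> A" "affine A"
    and uni: "unimodular_simplex (int_lattice \<inter> A) (convex hull C)"
    and x: "y \<in> A" "real k *\<^sub>R y \<in> int_lattice"
  obtains n :: "real ^ 'n \<Rightarrow> int"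
    where "sum n C = int k" "(\<Sum>v\<in>C. real_of_int (n v) *\<^sub>R v) = real k *\<^sub>R y"
proof -
  define L where "L = int_lattice \<inter> A"
  have fin: "finite C" using C(1) aff_independent_finite by blast
  have vert: "vertices (convex hull C) = C"
    using extreme_point_of_convex_hull_affine_independent[OF C(1)] by (auto simp: vertices_def)
  obtain v where v: "v \<in> C" "C \<subseteq> L"
      and span: "int_module.span ((\<lambda>w. w - v) ` (C - {v})) = {x - y |x y. x \<in> L \<and> y \<in> L}"
    using uni by (auto simp: unimodular_simplex_def vert is_int_basis_def L_def)
  let ?B = "(\<lambda>w. w - v) ` (C - {v})"
  have "v + real k *\<^sub>R (y - v) \<in> A"
  proof -
    have "(1 - real k) *\<^sub>R v + real k *\<^sub>R y \<in> A"
      by (rule mem_affine[OF C(3)]) (use v C x in auto)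
    then show ?thesis by (simp add: algebra_simps)
  qed
  moreover have "v + real k *\<^sub>R (y - v) \<in> int_lattice"
  proof -
    have "v \<in> int_lattice" using v by (auto simp: L_def)
    moreover from this have "real k *\<^sub>R v \<in> int_lattice" by (auto simp: int_lattice_def)
    ultimately show ?thesis
      unfolding scaleR_diff_right by (intro int_lattice_add int_lattice_diff x)
  qed
  ultimately have "v + real k *\<^sub>R (y - v) \<in> L" by (simp add: L_def)
  then have "real k *\<^sub>R (y - v) \<in> {x - y |x y. x \<in> L \<and> y \<in> L}"
    using v by (intro CollectI exI[of _ "v + real k *\<^sub>R (y - v)"] exI[of _ v]) auto
  then have "real k *\<^sub>R (y - v) \<in> int_module.span ?B" by (simp only: span)
  then obtain m where m: "real k *\<^sub>R (y - v) = (\<Sum>b\<in>?B. real_of_int (m b) *\<^sub>R b)"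
    using int_module.span_finite[of ?B] fin by auto
  then have m': "real k *\<^sub>R (y - v) = (\<Sum>w\<in>C - {v}. real_of_int (m (w - v)) *\<^sub>R (w - v))"
    by (simp add: sum.reindex inj_on_def)
  define n where "n w = (if w = v then int k - (\<Sum>w\<in>C - {v}. m (w - v)) else m (w - v))" for w
  have s: "sum n (C - {v}) = (\<Sum>w\<in>C - {v}. m (w - v))"
    by (auto simp: n_def intro: sum.cong)
  have "sum n C = int k"
    unfolding sum.remove[OF fin v(1)] s by (simp add: n_def)
  moreover have "(\<Sum>w\<in>C. real_of_int (n w) *\<^sub>R w) = real k *\<^sub>R y"
  proof -
    have "(\<Sum>w\<in>C. real_of_int (n w) *\<^sub>R w)
        = real_of_int (n v) *\<^sub>R v + (\<Sum>w\<in>C - {v}. real_of_int (m (w - v)) *\<^sub>R w)"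
      unfolding sum.remove[OF fin v(1)]
      by (intro arg_cong2[of _ _ _ _ "(+)"] sum.cong refl) (auto simp: n_def)
    also have "\<dots> = real k *\<^sub>R v + (\<Sum>w\<in>C - {v}. real_of_int (m (w - v)) *\<^sub>R (w - v))"
      by (simp add: n_def scaleR_diff_left scaleR_diff_right sum_subtractf scaleR_sum_left)
    also have "\<dots> = real k *\<^sub>R y" by (simp only: m'[symmetric]) (simp add: scaleR_diff_right)
    finally show ?thesis .
  qed
  ultimately show ?thesis using that by blast
qed

text \<open>
  The weights are \<open>k\<close> times the barycentric coordinates. These are unique, so the integer coordinates
  provided by unimodularity coincide with them and inherit their signs: they are nonnegative on the
  simplex, and positive at \<open>u\<close> exactly off the facet opposite to \<open>u\<close>. The restriction to
  \<open>k > 0\<close> is essential, since dilation by \<open>0\<close> sends even a half-open simplex to the origin.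
\<close>

lemma half_open_simplex_lattice_points:
  fixes C :: "(real ^ 'n) set"
  assumes C: "\<not> affine_dependent C" "C \<subseteq> A" "affine A"
    and uni: "unimodular_simplex (int_lattice \<inter> A) (convex hull C)"
    and U: "U \<subseteq> C" and k: "0 < k"
  shows "bij_betw (\<lambda>f. \<Sum>v\<in>C. real (f v) *\<^sub>R v) (weights C U k)
     ((\<lambda>x. real k *\<^sub>R x) ` (convex hull C - (\<Union>u\<in>U. convex hull (C - {u}))) \<inter> int_lattice)"
    (is "bij_betw ?p _ (?s ` ?H \<inter> _)")
proof (rule bij_betw_imageI)
  have fin: "finite C" using C(1) aff_independent_finite by blast
  have vert: "vertices (convex hull C) = C"
    using extreme_point_of_convex_hull_affine_independent[OF C(1)] by (auto simp: vertices_def)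
  show "inj_on ?p (weights C U k)"
  proof (rule inj_onI)
    fix f g assume fg: "f \<in> weights C U k" "g \<in> weights C U k" "?p f = ?p g"
    have "f v = g v" for v
    proof (cases "v \<in> C")
      case True
      have "sum (\<lambda>v. real (f v)) C = sum (\<lambda>v. real (g v)) C"
        using fg(1,2) by (simp add: weights_def flip: of_nat_sum)
      then show ?thesis
        using affine_independent_coeffs_unique[OF fin C(1) _ fg(3) True] by simp
    qed (use fg in \<open>simp add: weights_def\<close>)
    then show "f = g" by auto
  qed
  show "?p ` weights C U k = ?s ` ?H \<inter> int_lattice"
  proof (intro equalityI subsetI)
    fix x assume "x \<in> ?p ` weights C U k"
    then obtain f where f: "f \<in> weights C U k" "x = ?p f" by auto
    define l where "l v = real (f v) / real k" for v
    have l: "0 \<le> l v" for v by (simp add: l_def)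
    have l1: "sum l C = 1"
      using f k by (simp add: l_def weights_def flip: sum_divide_distrib of_nat_sum)
    have x: "x = real k *\<^sub>R (\<Sum>v\<in>C. l v *\<^sub>R v)"
      using k by (simp add: f l_def scaleR_sum_right)
    have "(\<Sum>v\<in>C. l v *\<^sub>R v) \<in> convex hull C"
      using l l1 by (auto simp: convex_hull_finite[OF fin])
    moreover have "(\<Sum>v\<in>C. l v *\<^sub>R v) \<notin> convex hull (C - {u})" if "u \<in> U" for u
    proof -
      have "l u \<noteq> 0" using f that k by (force simp: l_def weights_def)
      then show ?thesis using barycentric_notin_facet_iff[OF C(1) l l1] U that by auto
    qed
    moreover have "x \<in> int_lattice"
    proof -
      have "C \<subseteq> int_lattice" using uni by (auto simp: unimodular_simplex_def vert)
      then show ?thesis using int_lattice_sum[of C "\<lambda>v. int (f v)"] f by auto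
    qed
    ultimately show "x \<in> ?s ` ?H \<inter> int_lattice" using x by auto
  next
    fix x assume "x \<in> ?s ` ?H \<inter> int_lattice"
    then obtain y where y: "y \<in> ?H" "x = real k *\<^sub>R y" "x \<in> int_lattice" by auto
    have "y \<in> A" using y(1) hull_minimal[OF C(2), of convex] C(3) by (auto simp: affine_imp_convex)
    obtain n where n: "sum n C = int k" "(\<Sum>v\<in>C. real_of_int (n v) *\<^sub>R v) = real k *\<^sub>R y"
      by (rule unimodular_integer_coordinates[OF C uni \<open>y \<in> A\<close>, of k]) (use y in auto)
    obtain l where l: "\<And>v. v \<in> C \<Longrightarrow> 0 \<le> l v" "sum l C = 1" "(\<Sum>v\<in>C. l v *\<^sub>R v) = y"
      using y(1) by (auto simp: convex_hull_finite[OF fin])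
    have nl: "real_of_int (n v) = real k * l v" if "v \<in> C" for v
    proof (rule affine_independent_coeffs_unique[OF fin C(1) _ _ that])
      show "(\<Sum>v\<in>C. real_of_int (n v)) = (\<Sum>v\<in>C. real k * l v)"
        using n(1) l(2) by (simp flip: sum_distrib_left of_int_sum)
      show "(\<Sum>v\<in>C. real_of_int (n v) *\<^sub>R v) = (\<Sum>v\<in>C. (real k * l v) *\<^sub>R v)"
        using n(2) l(3) by (simp flip: scaleR_sum_right scaleR_scaleR)
    qed
    have n0: "0 \<le> n v" if "v \<in> C" for v
      using nl[OF that] l(1)[OF that] by (metis mult_nonneg_nonneg of_int_0_le_iff of_nat_0_le_iff)
    define f where "f v = (if v \<in> C then nat (n v) else 0)" for v
    have "int (sum f C) = int k"
      unfolding n(1)[symmetric] of_nat_sum by (intro sum.cong) (auto simp: f_def n0)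
    then have "sum f C = k" by (simp only: of_nat_eq_iff)
    moreover have "1 \<le> f u" if "u \<in> U" for u
    proof -
      have "u \<in> C" using that U by auto
      have "l u \<noteq> 0"
        using barycentric_notin_facet_iff[OF C(1) l(1,2) \<open>u \<in> C\<close>] l(3) y(1) that by auto
      then have "n u \<noteq> 0" using nl[OF \<open>u \<in> C\<close>] k by auto
      then show ?thesis using n0[OF \<open>u \<in> C\<close>] \<open>u \<in> C\<close> by (simp add: f_def)
    qed
    ultimately have "f \<in> weights C U k" by (auto simp: weights_def f_def)
    moreover have "?p f = x"
      unfolding y(2) n(2)[symmetric] by (intro sum.cong) (auto simp: f_def n0)
    ultimately show "x \<in> ?p ` weights C U k" by blast
  qed
qed

section \<open>The Ehrhart series of a shelled polytope\<close>

lemma attaching_number_eq_card: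
  assumes "k simplex (\<sigma> ! i)" "i \<noteq> 0" "attaching_facets \<sigma> i \<F>"
  shows "attaching_number \<sigma> i = card \<F>"
proof -
  have "(THE r. \<exists>\<F>. attaching_facets \<sigma> i \<F> \<and> r = card \<F>) = card \<F>"
    using assms attaching_facets_unique by (intro the_equality) blast+
  then show ?thesis using assms(2) by (simp add: attaching_number_def)
qed

text \<open>
  The part added by the \<open>i\<close>-th simplex, described by vertices: \<open>C\<close> is the vertex set of the simplex,
  and \<open>U\<close> consists of the vertices opposite to the facets along which it is attached. The
  inclusion of \<open>U\<close> in \<open>C\<close> is strict because some facet stays free; this is what bounds the attaching
  numbers by \<open>d\<close>.
\<close>

definition new_part :: "nat \<Rightarrow> 'a::euclidean_space set list \<Rightarrow> nat \<Rightarrow> 'a set \<Rightarrow> 'a set \<Rightarrow> bool" where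
  "new_part d \<sigma> i C U \<longleftrightarrow>
     \<not> affine_dependent C \<and> \<sigma> ! i = convex hull C \<and> card C = d + 1 \<and>
     U \<subset> C \<and> card U = attaching_number \<sigma> i \<and> (U = {} \<longleftrightarrow> i = 0) \<and>
     \<sigma> ! i - (\<Union>j<i. \<sigma> ! j) = convex hull C - (\<Union>u\<in>U. convex hull (C - {u}))"

lemma shelling_new_part_exists:
  fixes \<sigma> :: "'a::euclidean_space set list"
  assumes simp: "\<And>j. j < n \<Longrightarrow> int d simplex (\<sigma> ! j)"
    and hull: "\<And>j. j < n \<Longrightarrow> affine hull (\<sigma> ! j) = A"
    and shell: "\<And>i. 1 \<le> i \<Longrightarrow> i < n \<Longrightarrow> \<exists>\<F>. attaching_facets \<sigma> i \<F>"
    and i: "i < n"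
  shows "\<exists>C U. new_part d \<sigma> i C U"
proof -
  obtain C where C: "\<not> affine_dependent C" "\<sigma> ! i = convex hull C" "card C = d + 1"
    using simp[OF i] by (auto simp: simplex_def)
  have "\<exists>U. U \<subset> C \<and> card U = attaching_number \<sigma> i \<and> (U = {} \<longleftrightarrow> i = 0)
    \<and> \<sigma> ! i \<inter> (\<Union>j<i. \<sigma> ! j) = (\<Union>u\<in>U. convex hull (C - {u}))"
  proof (cases "i = 0")
    case True
    have "C \<noteq> {}" using C(3) by auto
    then show ?thesis using True by (intro exI[of _ "{}"]) (auto simp: attaching_number_def)
  next
    case False
    then have i1: "1 \<le> i" by simp
    then obtain \<F> where F: "attaching_facets \<sigma> i \<F>" using shell i by blast
    have sub: "\<F> \<subseteq> {F. F facet_of convex hull C}" and ne: "\<F> \<noteq> {}"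
      and un: "\<sigma> ! i \<inter> (\<Union>j<i. \<sigma> ! j) = \<Union>\<F>"
      using F C(2) by (simp_all add: attaching_facets_def)
    obtain U where U: "U \<subseteq> C" "\<F> = (\<lambda>u. convex hull (C - {u})) ` U" "card \<F> = card U"
      using facets_of_simplex_by_vertices[OF C(1) sub] by blast
    have "AR (\<Union>j<i. \<sigma> ! j)"
      by (rule shelling_AR_initial_segment[OF simp _ hull shell i1]) (use i in \<open>auto simp: less_imp_le\<close>)
    moreover have "\<sigma> ! j \<subseteq> affine hull (\<sigma> ! i)" if "j < i" for j
      using hull[OF i] hull[of j] hull_subset[of "\<sigma> ! j" affine] that i by simp
    then have "(\<Union>j<i. \<sigma> ! j) \<subseteq> affine hull (\<sigma> ! i)" by blast
    ultimately have not_all: "\<F> \<noteq> {F. F facet_of \<sigma> ! i}"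
      using attaching_facets_omit_a_facet[OF simp[OF i] _ _ _ F] by simp
    have "U \<noteq> C"
    proof
      assume "U = C"
      then have "{F. F facet_of convex hull C} \<subseteq> \<F>"
        using facet_of_convex_hull_affine_independent[OF C(1)] U(2) by auto
      then show False using not_all sub unfolding C(2) by (simp add: subset_antisym)
    qed
    then have "U \<subset> C" using U(1) by blast
    moreover have "card U = attaching_number \<sigma> i"
      using attaching_number_eq_card[OF simp[OF i] False F] U(3) by simp
    moreover have "U \<noteq> {}" using U(2) ne by blast
    ultimately show ?thesis using un U(2) False by blast
  qed
  then obtain U where U: "U \<subset> C" "card U = attaching_number \<sigma> i" "U = {} \<longleftrightarrow> i = 0"
    "\<sigma> ! i \<inter> (\<Union>j<i. \<sigma> ! j) = (\<Union>u\<in>U. convex hull (C - {u}))" by blast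
  have "\<sigma> ! i - (\<Union>j<i. \<sigma> ! j) = convex hull C - (\<Union>u\<in>U. convex hull (C - {u}))"
    using U(4) C(2) by blast
  with C U show ?thesis unfolding new_part_def by blast
qed

text \<open>
  The new parts partition \<open>Q\<close>, and the generating function of the lattice points of each one is known
  from its attaching number.
\<close>

lemma unimodular_shelling_ehrhart_series:
  fixes Q :: "(real ^ 'n) set"
  assumes dim: "aff_dim Q = int d" and D: "unimodular_dissection Q D" and sh: "shelling_order D \<sigma>"
  shows "(1 - fps_X) ^ (d + 1) * ehrhart_series Q
           = (\<Sum>i<length \<sigma>. fps_X ^ attaching_number \<sigma> i)" (is ?series)
    and "i < length \<sigma> \<Longrightarrow> attaching_number \<sigma> i \<le> d"
proof -
  define n where "n = length \<sigma>"
  define A where "A = affine hull Q"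
  have set: "set \<sigma> = D" and shell: "\<And>i. 1 \<le> i \<Longrightarrow> i < n \<Longrightarrow> \<exists>\<F>. attaching_facets \<sigma> i \<F>"
    using sh by (auto simp: shelling_order_def n_def)
  have inD: "\<sigma> ! i \<in> D" if "i < n" for i using that set by (auto simp: n_def)
  have simp: "int d simplex (\<sigma> ! i)" and uni: "unimodular_simplex (int_lattice \<inter> A) (\<sigma> ! i)"
    if "i < n" for i
    using inD[OF that] D dim by (auto simp: unimodular_dissection_def dissection_def A_def)
  have Q: "Q = (\<Union>i<n. \<sigma> ! i)"
  proof -
    have "Q = \<Union>(set \<sigma>)" using D set by (simp add: unimodular_dissection_def dissection_def)
    then show ?thesis by (auto simp: n_def set_conv_nth)
  qed
  have hull: "affine hull (\<sigma> ! i) = A" if "i < n" for i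
    using aff_dim_eq_full_gen[of "\<sigma> ! i" Q] aff_dim_simplex[OF simp[OF that]] dim that Q
    by (auto simp: A_def)
  have "\<forall>i<n. \<exists>C U. new_part d \<sigma> i C U"
    using shelling_new_part_exists[OF simp hull shell] by simp
  then obtain C U where CU: "\<And>i. i < n \<Longrightarrow> new_part d \<sigma> i (C i) (U i)"
    by metis
  have C: "\<not> affine_dependent (C i)" "\<sigma> ! i = convex hull (C i)" "card (C i) = d + 1"
    and U: "U i \<subset> C i" "card (U i) = attaching_number \<sigma> i" "U i = {} \<longleftrightarrow> i = 0"
      "\<sigma> ! i - (\<Union>j<i. \<sigma> ! j) = convex hull (C i) - (\<Union>u\<in>U i. convex hull (C i - {u}))"
    if "i < n" for i
    using CU[OF that] unfolding new_part_def by blast+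
  have fin: "finite (C i)" if "i < n" for i using C(1)[OF that] aff_independent_finite by blast
  show "attaching_number \<sigma> i \<le> d" if "i < length \<sigma>"
  proof -
    have i: "i < n" using that by (simp add: n_def)
    show ?thesis using psubset_card_mono[OF fin[OF i] U(1)[OF i]] C(3)[OF i] U(2)[OF i] by simp
  qed
  let ?W = "\<lambda>i. Abs_fps (\<lambda>k. int (card (weights (C i) (U i) k)))"
  have "ehrhart_series Q = (\<Sum>i<n. ?W i)"
  proof (intro fps_ext)
    fix k
    have "card ((\<lambda>x. real k *\<^sub>R x) ` Q \<inter> int_lattice) = (\<Sum>i<n. card (weights (C i) (U i) k))"
    proof (cases "k = 0")
      case True
      (* Only the first simplex has a weight of total 0, matching the single lattice point of 0 Q. *)
      have "Q \<noteq> {}" using dim by auto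
      then have "(\<lambda>x. real k *\<^sub>R x) ` Q \<inter> int_lattice = {0}" "0 < n"
        using True Q by (auto simp: int_lattice_def)
      moreover have "card (weights (C i) (U i) 0) = (if i = 0 then 1 else 0)" if "i < n" for i
        using weights_0[OF fin[OF that]] U(1,3)[OF that] by auto
      ultimately show ?thesis using True by simp
    next
      case False
      define H where "H i = \<sigma> ! i - (\<Union>j<i. \<sigma> ! j)" for i
      have H: "H = disjointed ((!) \<sigma>)"
        by (auto simp: H_def disjointed_def fun_eq_iff atLeast0LessThan)
      let ?P = "\<lambda>i. (\<lambda>x. real k *\<^sub>R x) ` H i \<inter> int_lattice"
      have bij: "bij_betw (\<lambda>f. \<Sum>v\<in>C i. real (f v) *\<^sub>R v) (weights (C i) (U i) k) (?P i)"
        if i: "i < n" for i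
      proof -
        have "H i = convex hull (C i) - (\<Union>u\<in>U i. convex hull (C i - {u}))"
          using U(4)[OF i] by (simp add: H_def)
        moreover have "C i \<subseteq> A"
          using hull[OF i] C(2)[OF i] hull_subset[of "C i" affine] by (simp add: affine_hull_convex_hull)
        moreover have "unimodular_simplex (int_lattice \<inter> A) (convex hull (C i))"
          using uni[OF i] C(2)[OF i] by simp
        ultimately show ?thesis
          using half_open_simplex_lattice_points[OF C(1)[OF i], of A "U i" k] U(1)[OF i] False
          by (auto simp: A_def)
      qed
      have QH: "Q = (\<Union>i<n. H i)"
        using finite_UN_disjointed_eq[of "(!) \<sigma>" n] by (simp add: Q H atLeast0LessThan)
      have "(\<lambda>x. real k *\<^sub>R x) ` Q \<inter> int_lattice = (\<Union>i<n. ?P i)"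
        unfolding QH image_UN by blast
      moreover have "card (\<Union>i<n. ?P i) = (\<Sum>i<n. card (?P i))"
      proof (rule card_UN_disjoint)
        show "\<forall>i\<in>{..<n}. finite (?P i)"
        proof
          fix i assume "i \<in> {..<n}"
          then have i: "i < n" by simp
          show "finite (?P i)"
            using bij_betw_finite[OF bij[OF i]] finite_weights[OF fin[OF i]] U(1)[OF i] by blast
        qed
        show "\<forall>i\<in>{..<n}. \<forall>j\<in>{..<n}. i \<noteq> j \<longrightarrow> ?P i \<inter> ?P j = {}"
        proof (intro ballI impI)
          fix i j :: nat assume "i \<noteq> j"
          then have "H i \<inter> H j = {}"
            using disjoint_family_disjointed[of "(!) \<sigma>"] by (auto simp: disjoint_family_on_def H)
          then show "?P i \<inter> ?P j = {}" using False by auto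
        qed
      qed simp
      ultimately show ?thesis using bij_betw_same_card[OF bij] by simp
    qed
    then show "ehrhart_series Q $ k = (\<Sum>i<n. ?W i) $ k"
      by (simp add: ehrhart_series_def fps_sum_nth)
  qed
  then have "(1 - fps_X) ^ (d + 1) * ehrhart_series Q = (\<Sum>i<n. (1 - fps_X) ^ (d + 1) * ?W i)"
    by (simp only: sum_distrib_left)
  also have "\<dots> = (\<Sum>i<n. fps_X ^ attaching_number \<sigma> i)"
  proof (rule sum.cong[OF refl])
    fix i assume "i \<in> {..<n}"
    then have i: "i < n" by simp
    show "(1 - fps_X) ^ (d + 1) * ?W i = fps_X ^ attaching_number \<sigma> i"
      using weights_generating_function[OF fin[OF i], of "U i"] U(1,2)[OF i] C(3)[OF i] by auto
  qed
  finally show ?series by (simp add: n_def)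
qed

lemma sum_monom_eq_h_vector:
  assumes "\<And>i. i < length \<sigma> \<Longrightarrow> attaching_number \<sigma> i \<le> d"
  shows "(\<Sum>i<length \<sigma>. monom (1::int) (attaching_number \<sigma> i)) = (\<Sum>j\<le>d. monom (int (h_vector \<sigma> j)) j)"
proof -
  have "(\<Sum>i<length \<sigma>. monom (1::int) (attaching_number \<sigma> i))
      = (\<Sum>j\<le>d. \<Sum>i | i \<in> {..<length \<sigma>} \<and> attaching_number \<sigma> i = j. monom 1 (attaching_number \<sigma> i))"
    by (rule sum.group[symmetric]) (use assms in auto)
  also have "\<dots> = (\<Sum>j\<le>d. monom (int (h_vector \<sigma> j)) j)"
    by (intro sum.cong) (simp_all add: h_vector_def of_nat_poly mult_monom flip: monom_0)
  finally show ?thesis .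
qed

text \<open>
  The polynomial \<open>p\<close> with coefficients \<open>h\<^sub>j\<close> has degree at most \<open>d\<close> and satisfies the equation
  that defines the \<open>h\<^sup>*\<close>-polynomial, so the two agree. The first conjunct is the same
  identity after reversing the order of the coefficients.
\<close>

theorem proposition4p3:
  fixes Q :: "(real ^ 'n) set" and d :: nat
    and D :: "(real ^ 'n) set set" and \<sigma> :: "(real ^ 'n) set list"
  assumes "lattice_polytope Q" and "aff_dim Q = int d"
    and "unimodular_dissection Q D"
    and "shelling_order D \<sigma>"
  shows "(\<forall>t::real. t \<noteq> 0 \<longrightarrow>
            (\<Sum>i\<le>d. of_int (hstar Q i) * t ^ i) = t ^ (d + 1) * poly (h_poly d \<sigma>) (1 / t)) \<and>
         (\<Sum>i\<le>d. monom (hstar Q i) i) = (\<Sum>j\<le>d. monom (int (h_vector \<sigma> j)) j)"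
proof -
  note series = unimodular_shelling_ehrhart_series[OF assms(2-4)]
  define p where "p = (\<Sum>j\<le>d. monom (int (h_vector \<sigma> j)) j)"
  have p: "p = (\<Sum>i<length \<sigma>. monom 1 (attaching_number \<sigma> i))"
    unfolding p_def using sum_monom_eq_h_vector[OF series(2)] by simp
  have deg: "degree p \<le> d"
    unfolding p_def by (intro degree_sum_le) (auto intro: degree_monom_le order_trans)
  have fps: "fps_of_poly p = (1 - fps_X) ^ (d + 1) * ehrhart_series Q"
    unfolding series(1) by (simp add: p fps_of_poly_sum fps_of_poly_monom')
  have "hstar_poly Q = p"
    unfolding hstar_poly_def Let_def assms(2) nat_int
    by (rule the_equality) (use deg fps in \<open>auto simp flip: fps_of_poly_eq_iff\<close>)
  then have hstar: "hstar Q i = int (h_vector \<sigma> i)" if "i \<le> d" for i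
    using that by (simp add: hstar_def p_def coeff_sum)
  have "(\<Sum>i\<le>d. of_int (hstar Q i) * t ^ i) = t ^ (d + 1) * poly (h_poly d \<sigma>) (1 / t)"
    if "t \<noteq> 0" for t :: real
  proof -
    have "t ^ (d + 1) * poly (h_poly d \<sigma>) (1 / t)
        = (\<Sum>j\<le>d. real (h_vector \<sigma> j) * (t ^ (d + 1) * (1 / t) ^ (d + 1 - j)))"
      by (simp add: h_poly_def poly_sum poly_monom sum_distrib_left mult_ac)
    also have "\<dots> = (\<Sum>j\<le>d. of_int (hstar Q j) * t ^ j)"
    proof (rule sum.cong[OF refl])
      fix j assume "j \<in> {..d}"
      then have "t ^ (d + 1) = t ^ j * t ^ (d + 1 - j)" by (simp flip: power_add)
      then have "t ^ (d + 1) * (1 / t) ^ (d + 1 - j) = t ^ j"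
        using that by (simp add: power_one_over)
      then show "real (h_vector \<sigma> j) * (t ^ (d + 1) * (1 / t) ^ (d + 1 - j)) = of_int (hstar Q j) * t ^ j"
        using hstar \<open>j \<in> {..d}\<close> by simp
    qed
    finally show ?thesis by simp
  qed
  moreover have "(\<Sum>i\<le>d. monom (hstar Q i) i) = (\<Sum>j\<le>d. monom (int (h_vector \<sigma> j)) j)"
    using hstar by simp
  ultimately show ?thesis by blast
qed

end
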